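(* Let $(X,d)$ be a relatively compact metric space, let $F=\{f_n\}_{n\in\mathbb N}$ be a time varying homeomorphism on $X$, and let $\mu$ be a non-atomic Borel measure on $X$. If $\mu$ is expansive with respect to $F$ and persistent with respect to $F$, then $\mu$ is topologically stable with respect to $F$ in the class of all time varying homeomorphisms of $X$.
   Context: $\mathbb N$ denotes the non-negative integers. A metric space is called relatively compact here if its closed bounded subsets are compact. A bi-measurable map is a Borel measurable bijection with Borel measurable inverse. A time varying bi-measurable map on $X$ is a family $F=\{f_n\}_{n\in\mathbb N}$ of bi-measurable maps $f_n:X\to X$ with $f_0=\mathrm{id}_X$; it is a time varying homeomorphism if every $f_n$ is a homeomorphism. Put $F_n=f_n\circ f_{n-1}\circ\cdots\circ f_1\circ f_0$ for $n\ge 0$ and $F_n=f_{-n}^{-1}\circ f_{-(n-1)}^{-1}\circ\cdots\circ f_1^{-1}\circ f_0^{-1}$ for $n<0$. For another family $G=\{g_n\}$, $G_n$ is defined in the same way. A Borel measure $\mu$ is non-atomic if $\mu(\{x\})=0$ for all $x\in X$. Expansive: a non-atomic Borel measure $\mu$ is expansive with respect to $F$ if there is $\delta>0$ such that $\mu(\Gamma_\delta(x))=0$ for all $x\in X$, where $\Gamma_\delta(x)=\{y\in X: d(F_n(x),F_n(y))\le\delta \text{ for all } n\in\mathbb Z\}$. Distance: let $d_1(x,y)=\min\{d(x,y),1\}$, $\eta(f,g)=\sup_{x\in X}d_1(f(x),g(x))$, and $p(F,G)=\max\{\sup_{n\in\mathbb N}\eta(f_n,g_n),\ \sup_{n\in\mathbb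 N}\eta(f_n^{-1},g_n^{-1})\}$. Persistent: $\mu$ is persistent with respect to $F$ if for every $\epsilon>0$ there are $0<\delta<1$ and a measurable set $B\subset X$ with $\mu(X\setminus B)=0$ such that for every time varying bi-measurable map $G$ with $p(F,G)<\delta$ and every $x\in B$ there is $y\in X$ with $d(F_n(y),G_n(x))<\epsilon$ for all $n\in\mathbb Z$. Set valued maps: for $H:X\to\mathcal P(X)$ (power set), $Dom(H)=\{x: H(x)\ne\emptyset\}$; $H$ is compact valued if each $H(x)$ is compact; $H$ is upper semi-continuous if for every $x\in Dom(H)$ and every open neighbourhood $O$ of $H(x)$ there is $\delta>0$ with $H(y)\subset O$ whenever $d(x,y)<\delta$. We write $d(H,Id)<\epsilon$ if $H(x)\subset B(x,\epsilon)$ (open ball) for every $x\in X$, and $\mu\circ H=0$ if $\mu(H(x))=0$ for every $x\in X$. $B[x,\epsilon]$ is the closed ball. Topologically stable in the class of time varying homeomorphisms: for every $\epsilon>0$ there is $0<\delta<1$ such that for every time varying homeomorphism $G$ on $X$ with $p(F,G)<\delta$ there is an upper semi-continuous compact valued map $H:X\to\mathcal P(X)$ with measurable domain such that (i) $\mu(X\setminus Dom(H))=0$, (ii) $\mu\circ H=0$, (iii) $d(H,Id)<\epsilon$, (iv) $F_n(H(x))\subset B[G_n(x),\epsilon]$ for all $x\in X$ and $n\in\mathbb Z$. *)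

theory Defs
  imports "HOL-Analysis.Analysis"
begin

definition bimeasurable :: "('a::metric_space \<Rightarrow> 'a) \<Rightarrow> bool" where
  "bimeasurable f \<longleftrightarrow> bij f \<and> f \<in> borel \<rightarrow>\<^sub>M borel \<and> inv f \<in> borel \<rightarrow>\<^sub>M borel"

definition time_varying_bimeasurable :: "(nat \<Rightarrow> 'a::metric_space \<Rightarrow> 'a) \<Rightarrow> bool" where
  "time_varying_bimeasurable F \<longleftrightarrow> F 0 = id \<and> (\<forall>n. bimeasurable (F n))"

definition time_varying_homeomorphism :: "(nat \<Rightarrow> 'a::metric_space \<Rightarrow> 'a) \<Rightarrow> bool" where
  "time_varying_homeomorphism F \<longleftrightarrow>
     time_varying_bimeasurable F \<and> (\<forall>n. \<exists>g. homeomorphism UNIV UNIV (F n) g)"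

primrec compose_upto :: "(nat \<Rightarrow> 'a \<Rightarrow> 'a) \<Rightarrow> nat \<Rightarrow> 'a \<Rightarrow> 'a" where
  "compose_upto F 0 = F 0"
| "compose_upto F (Suc n) = F (Suc n) \<circ> compose_upto F n"

text \<open>For negative indices the inverses are composed in the same order as the maps are for
  positive ones, so \<open>tv_iterate F (- n)\<close> is in general not the inverse of \<open>tv_iterate F n\<close>.\<close>

definition tv_iterate :: "(nat \<Rightarrow> 'a \<Rightarrow> 'a) \<Rightarrow> int \<Rightarrow> 'a \<Rightarrow> 'a" where
  "tv_iterate F n =
     (if n \<ge> 0 then compose_upto F (nat n)
      else compose_upto (\<lambda>k. inv (F k)) (nat (- n)))"

definition nonatomic :: "'a measure \<Rightarrow> bool" where
  "nonatomic \<mu> \<longleftrightarrow> (\<forall>x. emeasure \<mu> {x} = 0)"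

definition dynamic_ball :: "(nat \<Rightarrow> 'a::metric_space \<Rightarrow> 'a) \<Rightarrow> real \<Rightarrow> 'a \<Rightarrow> 'a set" where
  "dynamic_ball F \<delta> x = {y. \<forall>n. dist (tv_iterate F n x) (tv_iterate F n y) \<le> \<delta>}"

text \<open>Here and below \<^const>\<open>null_sets\<close> is used in place of an equation for \<^const>\<open>emeasure\<close>
  wherever measurability of the set is not stated separately, because \<^const>\<open>emeasure\<close> is
  0 by convention on non-measurable sets.\<close>

definition expansive_measure ::
    "'a::metric_space measure \<Rightarrow> (nat \<Rightarrow> 'a \<Rightarrow> 'a) \<Rightarrow> bool" where
  "expansive_measure \<mu> F \<longleftrightarrow> (\<exists>\<delta>>0. \<forall>x. dynamic_ball F \<delta> x \<in> null_sets \<mu>)"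

definition trunc_dist :: "'a::metric_space \<Rightarrow> 'a \<Rightarrow> real" where
  "trunc_dist x y = min (dist x y) 1"

text \<open>The suprema below are over nonempty sets of reals contained in \<open>{0..1}\<close>.\<close>

definition map_dist :: "('a::metric_space \<Rightarrow> 'a) \<Rightarrow> ('a \<Rightarrow> 'a) \<Rightarrow> real" where
  "map_dist f g = (SUP x. trunc_dist (f x) (g x))"

definition tv_dist ::
    "(nat \<Rightarrow> 'a::metric_space \<Rightarrow> 'a) \<Rightarrow> (nat \<Rightarrow> 'a \<Rightarrow> 'a) \<Rightarrow> real" where
  "tv_dist F G = max (SUP n. map_dist (F n) (G n)) (SUP n. map_dist (inv (F n)) (inv (G n)))"

definition persistent_measure ::
    "'a::metric_space measure \<Rightarrow> (nat \<Rightarrow> 'a \<Rightarrow> 'a) \<Rightarrow> bool" where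
  "persistent_measure \<mu> F \<longleftrightarrow>
     (\<forall>\<epsilon>>0. \<exists>\<delta> B. 0 < \<delta> \<and> \<delta> < 1 \<and> B \<in> sets \<mu> \<and> emeasure \<mu> (UNIV - B) = 0 \<and>
        (\<forall>G. time_varying_bimeasurable G \<longrightarrow> tv_dist F G < \<delta> \<longrightarrow>
           (\<forall>x\<in>B. \<exists>y. \<forall>n. dist (tv_iterate F n y) (tv_iterate G n x) < \<epsilon>)))"

definition Dom :: "('a \<Rightarrow> 'b set) \<Rightarrow> 'a set" where
  "Dom H = {x. H x \<noteq> {}}"

definition compact_valued :: "('a \<Rightarrow> 'b::topological_space set) \<Rightarrow> bool" where
  "compact_valued H \<longleftrightarrow> (\<forall>x. compact (H x))"

definition upper_semicontinuous ::
    "('a::metric_space \<Rightarrow> 'b::topological_space set) \<Rightarrow> bool" where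
  "upper_semicontinuous H \<longleftrightarrow>
     (\<forall>x\<in>Dom H. \<forall>U. open U \<longrightarrow> H x \<subseteq> U \<longrightarrow> (\<exists>\<delta>>0. \<forall>y. dist x y < \<delta> \<longrightarrow> H y \<subseteq> U))"

definition topologically_stable_measure ::
    "'a::metric_space measure \<Rightarrow> (nat \<Rightarrow> 'a \<Rightarrow> 'a) \<Rightarrow> bool" where
  "topologically_stable_measure \<mu> F \<longleftrightarrow>
     (\<forall>\<epsilon>>0. \<exists>\<delta>. 0 < \<delta> \<and> \<delta> < 1 \<and>
        (\<forall>G. time_varying_homeomorphism G \<longrightarrow> tv_dist F G < \<delta> \<longrightarrow>
           (\<exists>H :: 'a \<Rightarrow> 'a set.
              upper_semicontinuous H \<and> compact_valued H \<and> Dom H \<in> sets \<mu> \<and>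
              emeasure \<mu> (UNIV - Dom H) = 0 \<and>
              (\<forall>x. H x \<in> null_sets \<mu>) \<and>
              (\<forall>x. H x \<subseteq> ball x \<epsilon>) \<and>
              (\<forall>x n. tv_iterate F n ` H x \<subseteq> cball (tv_iterate G n x) \<epsilon>))))"

end

theory Submission
  imports Defs
begin

text \<open>Let \<open>H x\<close> be the set of all points whose \<open>F\<close>-orbit stays \<open>\<eta>\<close>-close to the \<open>G\<close>-orbit of \<open>x\<close>,
  where \<open>\<eta>\<close> is less than \<open>\<epsilon>\<close> and at most half an expansivity constant of \<open>\<mu>\<close>. Persistence makes
  \<open>H x\<close> nonempty for almost every \<open>x\<close>. Two points of \<open>H x\<close> have \<open>F\<close>-orbits within \<open>2 * \<eta>\<close> of each
  other, so \<open>H x\<close> lies in a dynamic ball and is null by expansivity. Finally \<open>H\<close> has a closed graph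
  and \<open>H x\<close> lies within \<open>\<eta>\<close> of \<open>x\<close>, so compactness of closed bounded sets gives upper
  semi-continuity, compact values and a closed domain.\<close>

lemma continuous_on_compose_upto:
  assumes "\<And>n. continuous_on UNIV (F n)"
  shows "continuous_on UNIV (compose_upto F n)"
proof (induction n)
  case 0
  show ?case using assms by simp
next
  case (Suc n)
  show ?case
    using continuous_on_compose[OF Suc] assms continuous_on_subset by (metis compose_upto.simps(2) subset_UNIV)
qed

text \<open>Iterates of negative index are built from the maps \<open>inv (F k)\<close>, and each of
  these agrees with the continuous inverse that \<open>homeomorphism\<close> supplies.\<close>

lemma continuous_on_tv_iterate:
  assumes "time_varying_homeomorphism F"
  shows "continuous_on UNIV (tv_iterate F n)"
proof -
  have *: "continuous_on UNIV (F k) \<and> continuous_on UNIV (inv (F k))" for k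
  proof -
    obtain g where g: "homeomorphism UNIV UNIV (F k) g"
      using assms by (auto simp: time_varying_homeomorphism_def)
    then have "inv (F k) = g"
      by (intro inv_equality) (auto simp: homeomorphism_def)
    with g show ?thesis
      by (auto simp: homeomorphism_def)
  qed
  show ?thesis
    using * by (cases "n \<ge> 0") (simp_all add: tv_iterate_def[abs_def] continuous_on_compose_upto)
qed

lemma tv_iterate_zero:
  assumes "time_varying_homeomorphism F"
  shows "tv_iterate F 0 x = x"
  using assms
  by (simp add: tv_iterate_def time_varying_homeomorphism_def time_varying_bimeasurable_def)

text \<open>As \<open>X\<close> converges and \<open>H\<close> moves points by at most
  \<open>r\<close>, all \<open>Y n\<close> lie in one closed ball around \<open>x\<close>, which is
  compact. A subsequence converges, and the closed graph puts its limit in \<open>H x\<close>. Both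
  the closed domain and upper semi-continuity rest on this.\<close>

lemma closed_graph_cluster_point:
  fixes H :: "'a::metric_space \<Rightarrow> 'a set"
  assumes heine_borel: "\<And>S :: 'a set. closed S \<Longrightarrow> bounded S \<Longrightarrow> compact S"
    and closed_graph: "closed {(x, y). y \<in> H x}"
    and near: "\<And>x. H x \<subseteq> cball x r"
    and lim: "X \<longlonglongrightarrow> x"
    and mem: "\<And>n. Y n \<in> H (X n)"
  obtains y s where "strict_mono s" "(Y \<circ> s) \<longlonglongrightarrow> y" "y \<in> H x"
proof -
  obtain e where e: "\<And>n. dist x (X n) \<le> e"
    using convergent_imp_bounded[OF lim] bounded_any_center[of "range X" x] by auto
  have Y: "Y n \<in> cball x (e + r)" for n
  proof -
    have "dist (X n) (Y n) \<le> r" using mem near by (auto simp: subset_iff)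
    with e[of n] show ?thesis
      using dist_triangle[of x "Y n" "X n"] by simp
  qed
  have "seq_compact (cball x (e + r))"
    using heine_borel by (simp add: compact_imp_seq_compact)
  then obtain y s where s: "strict_mono s" "(Y \<circ> s) \<longlonglongrightarrow> y"
    using Y unfolding seq_compact_def by blast
  have "(\<lambda>n. ((X \<circ> s) n, (Y \<circ> s) n)) \<longlonglongrightarrow> (x, y)"
    by (intro tendsto_Pair LIMSEQ_subseq_LIMSEQ[OF lim s(1)] s(2))
  then have "(x, y) \<in> {(x, y). y \<in> H x}"
    by (rule closed_sequentially[OF closed_graph, rotated]) (use mem in auto)
  with s that show thesis by auto
qed

text \<open>Each value is a section of the closed graph, hence closed, and it is bounded by
  \<open>near\<close>.\<close>

lemma closed_graph_imp_compact_valued: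
  fixes H :: "'a::metric_space \<Rightarrow> 'a set"
  assumes heine_borel: "\<And>S :: 'a set. closed S \<Longrightarrow> bounded S \<Longrightarrow> compact S"
    and closed_graph: "closed {(x, y). y \<in> H x}"
    and near: "\<And>x. H x \<subseteq> cball x r"
  shows "compact_valued H"
  unfolding compact_valued_def
proof
  fix x
  have "closed ((\<lambda>y. (x, y)) -` {(x, y). y \<in> H x})"
    using closed_graph by (intro closed_vimage continuous_intros)
  then have "closed (H x)"
    by (simp add: vimage_def)
  then show "compact (H x)"
    using heine_borel bounded_subset[OF bounded_cball near] by blast
qed

text \<open>Values chosen along a convergent sequence in the domain have a cluster point in the
  value at the limit. Closedness is what later makes the domain Borel measurable.\<close>

lemma closed_graph_imp_closed_Dom:
  fixes H :: "'a::metric_space \<Rightarrow> 'a set"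
  assumes heine_borel: "\<And>S :: 'a set. closed S \<Longrightarrow> bounded S \<Longrightarrow> compact S"
    and closed_graph: "closed {(x, y). y \<in> H x}"
    and near: "\<And>x. H x \<subseteq> cball x r"
  shows "closed (Dom H)"
  unfolding closed_sequential_limits
proof (intro allI impI, elim conjE)
  fix X x
  assume "\<forall>n. X n \<in> Dom H" and lim: "X \<longlonglongrightarrow> x"
  then have "\<forall>n. \<exists>y. y \<in> H (X n)"
    by (auto simp: Dom_def)
  then obtain Y where "\<And>n. Y n \<in> H (X n)"
    by metis
  then obtain y where "y \<in> H x"
    using closed_graph_cluster_point[of H, OF heine_borel closed_graph near lim] by blast
  then show "x \<in> Dom H"
    by (auto simp: Dom_def)
qed

text \<open>A failure at \<open>x\<close> yields \<open>X n\<close> tending to \<open>x\<close> and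
  \<open>Y n\<close> in \<open>H (X n)\<close> outside \<open>U\<close>. A cluster point of
  \<open>Y\<close> would lie both in \<open>H x\<close>, hence in \<open>U\<close>, and in the
  closed complement of \<open>U\<close>.\<close>

lemma closed_graph_imp_upper_semicontinuous:
  fixes H :: "'a::metric_space \<Rightarrow> 'a set"
  assumes heine_borel: "\<And>S :: 'a set. closed S \<Longrightarrow> bounded S \<Longrightarrow> compact S"
    and closed_graph: "closed {(x, y). y \<in> H x}"
    and near: "\<And>x. H x \<subseteq> cball x r"
  shows "upper_semicontinuous H"
  unfolding upper_semicontinuous_def
proof (intro ballI allI impI, rule ccontr)
  fix x U
  assume U: "open U" "H x \<subseteq> U"
    and neg: "\<not> (\<exists>\<delta>>0. \<forall>y. dist x y < \<delta> \<longrightarrow> H y \<subseteq> U)"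
  have "\<forall>n. \<exists>z y. dist x z < inverse (real (Suc n)) \<and> y \<in> H z \<and> y \<notin> U"
    using neg by (meson inverse_positive_iff_positive of_nat_0_less_iff subsetI zero_less_Suc)
  then obtain X Y where XY: "\<And>n. dist x (X n) < inverse (real (Suc n))"
      "\<And>n. Y n \<in> H (X n)" "\<And>n. Y n \<notin> U"
    by metis
  have "(\<lambda>n. dist (X n) x) \<longlonglongrightarrow> 0"
    by (rule tendsto_sandwich[OF _ _ tendsto_const LIMSEQ_inverse_real_of_nat])
      (use XY(1) in \<open>auto simp: dist_commute intro: always_eventually less_imp_le\<close>)
  then have "X \<longlonglongrightarrow> x"
    using tendsto_dist_iff by blast
  then obtain y s where y: "(Y \<circ> s) \<longlonglongrightarrow> y" "y \<in> H x"
    using closed_graph_cluster_point[of H r X x Y, OF heine_borel closed_graph near _ XY(2)] by blast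
  have "y \<in> - U"
    by (rule closed_sequentially[OF _ _ y(1)]) (use U XY(3) in auto)
  with y U show False by auto
qed

text \<open>The inequality is non-strict, although persistence gives a strict one, so that the graph
  is closed.\<close>

definition shadow_set ::
    "(nat \<Rightarrow> 'a::metric_space \<Rightarrow> 'a) \<Rightarrow> (nat \<Rightarrow> 'a \<Rightarrow> 'a) \<Rightarrow> real \<Rightarrow> 'a \<Rightarrow> 'a set" where
  "shadow_set F G \<eta> x = {y. \<forall>n. dist (tv_iterate F n y) (tv_iterate G n x) \<le> \<eta>}"

text \<open>The graph is an intersection over all integers \<open>n\<close> of sublevel sets of
  functions that are continuous because all iterates of \<open>F\<close> and \<open>G\<close>
  are.\<close>

lemma closed_graph_shadow_set:
  assumes "time_varying_homeomorphism F" "time_varying_homeomorphism G"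
  shows "closed {(x, y). y \<in> shadow_set F G \<eta> x}"
proof -
  have "continuous_on UNIV (\<lambda>z. dist (tv_iterate F n (snd z)) (tv_iterate G n (fst z)))" for n
    using assms
    by (intro continuous_on_dist continuous_on_compose2[OF continuous_on_tv_iterate]
        continuous_on_fst continuous_on_snd continuous_on_id) auto
  then have "closed {z. \<forall>n. dist (tv_iterate F n (snd z)) (tv_iterate G n (fst z)) \<le> \<eta>}"
    by (intro closed_Collect_all closed_Collect_le continuous_on_const)
  moreover have "{(x, y). y \<in> shadow_set F G \<eta> x} =
      {z. \<forall>n. dist (tv_iterate F n (snd z)) (tv_iterate G n (fst z)) \<le> \<eta>}"
    by (auto simp: shadow_set_def)
  ultimately show ?thesis by simp
qed

text \<open>This is the condition at index 0, where both iterates are the identity.\<close>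

lemma shadow_set_subset_cball:
  assumes "time_varying_homeomorphism F" "time_varying_homeomorphism G"
  shows "shadow_set F G \<eta> x \<subseteq> cball x \<eta>"
proof
  fix y
  assume "y \<in> shadow_set F G \<eta> x"
  then have "dist (tv_iterate F 0 y) (tv_iterate G 0 x) \<le> \<eta>"
    by (simp add: shadow_set_def)
  then show "y \<in> cball x \<eta>"
    by (simp add: tv_iterate_zero assms dist_commute)
qed

text \<open>The triangle inequality is applied through the \<open>G\<close>-orbit of
  \<open>x\<close>. The centre is a point \<open>y\<close> of the set itself, since the
  \<open>F\<close>-orbit of \<open>x\<close> may leave its \<open>G\<close>-orbit.\<close>

lemma shadow_set_subset_dynamic_ball:
  assumes "y \<in> shadow_set F G \<eta> x" "2 * \<eta> \<le> \<delta>"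
  shows "shadow_set F G \<eta> x \<subseteq> dynamic_ball F \<delta> y"
proof
  fix z
  assume z: "z \<in> shadow_set F G \<eta> x"
  have "dist (tv_iterate F n y) (tv_iterate F n z) \<le> \<delta>" for n
  proof -
    have "dist (tv_iterate F n y) (tv_iterate F n z) \<le>
        dist (tv_iterate F n y) (tv_iterate G n x) + dist (tv_iterate F n z) (tv_iterate G n x)"
      by (rule dist_triangle2)
    also have "\<dots> \<le> \<eta> + \<eta>"
      using assms z by (intro add_mono) (auto simp: shadow_set_def)
    finally show ?thesis using assms by simp
  qed
  then show "z \<in> dynamic_ball F \<delta> y"
    by (simp add: dynamic_ball_def)
qed

theorem theorem5p12:
  fixes F :: "nat \<Rightarrow> 'a::metric_space \<Rightarrow> 'a" and \<mu> :: "'a measure"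
  assumes relatively_compact: "\<And>S :: 'a set. closed S \<Longrightarrow> bounded S \<Longrightarrow> compact S"
    and "time_varying_homeomorphism F"
    and borel_measure: "sets \<mu> = sets borel"
    and "nonatomic \<mu>"
    and "expansive_measure \<mu> F"
    and "persistent_measure \<mu> F"
  shows "topologically_stable_measure \<mu> F"
  unfolding topologically_stable_measure_def
proof (intro allI impI)
  fix \<epsilon> :: real
  assume "\<epsilon> > 0"
  obtain e where "e > 0" and e: "\<And>x. dynamic_ball F e x \<in> null_sets \<mu>"
    using assms(5) by (auto simp: expansive_measure_def)
  \<comment> \<open>Strictness below \<epsilon> turns closed balls into the required open ones;
    twice \<eta> is at most the expansivity constant \<open>e\<close>.\<close>
  define \<eta> where "\<eta> = min \<epsilon> e / 2"
  have \<eta>: "0 < \<eta>" "\<eta> < \<epsilon>" "2 * \<eta> \<le> e"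
    using \<open>\<epsilon> > 0\<close> \<open>e > 0\<close> by (auto simp: \<eta>_def)
  \<comment> \<open>Persistence at scale \<eta> supplies \<delta> and \<open>B\<close> before
    \<open>G\<close> is chosen, so the same \<delta> serves for stability.\<close>
  obtain \<delta> B where \<delta>: "0 < \<delta>" "\<delta> < 1"
    and B: "B \<in> sets \<mu>" "emeasure \<mu> (UNIV - B) = 0"
    and shadow: "\<And>G x. time_varying_bimeasurable G \<Longrightarrow> tv_dist F G < \<delta> \<Longrightarrow> x \<in> B \<Longrightarrow>
        \<exists>y. \<forall>n. dist (tv_iterate F n y) (tv_iterate G n x) < \<eta>"
    using assms(6) \<eta>(1) unfolding persistent_measure_def by metis
  show "\<exists>\<delta>. 0 < \<delta> \<and> \<delta> < 1 \<and>
      (\<forall>G. time_varying_homeomorphism G \<longrightarrow> tv_dist F G < \<delta> \<longrightarrow>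
        (\<exists>H :: 'a \<Rightarrow> 'a set.
           upper_semicontinuous H \<and> compact_valued H \<and> Dom H \<in> sets \<mu> \<and>
           emeasure \<mu> (UNIV - Dom H) = 0 \<and>
           (\<forall>x. H x \<in> null_sets \<mu>) \<and>
           (\<forall>x. H x \<subseteq> ball x \<epsilon>) \<and>
           (\<forall>x n. tv_iterate F n ` H x \<subseteq> cball (tv_iterate G n x) \<epsilon>)))"
  proof (rule exI[of _ \<delta>], intro conjI allI impI \<delta>)
    fix G
    assume G: "time_varying_homeomorphism G" "tv_dist F G < \<delta>"
    let ?H = "shadow_set F G \<eta>"
    note graph = closed_graph_shadow_set[OF assms(2) G(1), of \<eta>]
    note near = shadow_set_subset_cball[OF assms(2) G(1), of \<eta>]
    have usc: "upper_semicontinuous ?H"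
      by (rule closed_graph_imp_upper_semicontinuous[OF relatively_compact graph near])
    have cv: "compact_valued ?H"
      by (rule closed_graph_imp_compact_valued[OF relatively_compact graph near])
    have dom: "Dom ?H \<in> sets \<mu>"
      using closed_graph_imp_closed_Dom[OF relatively_compact graph near] borel_measure by simp
    have "B \<subseteq> Dom ?H"
    proof
      fix x
      assume "x \<in> B"
      then obtain y where "\<forall>n. dist (tv_iterate F n y) (tv_iterate G n x) < \<eta>"
        using shadow[of G x] G by (auto simp: time_varying_homeomorphism_def)
      then have "y \<in> ?H x"
        by (auto simp: shadow_set_def intro: less_imp_le)
      then show "x \<in> Dom ?H"
        by (auto simp: Dom_def)
    qed
    then have "emeasure \<mu> (UNIV - Dom ?H) \<le> emeasure \<mu> (UNIV - B)"
      using B(1) borel_measure by (intro emeasure_mono) auto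
    then have full: "emeasure \<mu> (UNIV - Dom ?H) = 0"
      using B(2) by simp
    \<comment> \<open>A subset of a null set is null once it is measurable; here measurability comes
      from compactness. The dynamic ball needs a centre in the set, so the empty value is treated
      apart.\<close>
    have null: "?H x \<in> null_sets \<mu>" for x
    proof (cases "?H x = {}")
      case False
      then obtain y where "y \<in> ?H x" by auto
      moreover have "?H x \<in> sets \<mu>"
        using cv borel_measure by (simp add: compact_valued_def compact_imp_closed)
      ultimately show ?thesis
        using null_sets_subset[OF e] shadow_set_subset_dynamic_ball[OF _ \<eta>(3)] by blast
    qed simp
    have ball: "?H x \<subseteq> ball x \<epsilon>" for x
      using near[of x] \<eta>(2) by (auto simp: subset_iff)
    have image: "tv_iterate F n ` ?H x \<subseteq> cball (tv_iterate G n x) \<epsilon>" for x n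
    proof (rule image_subsetI)
      fix y
      assume "y \<in> ?H x"
      then have "dist (tv_iterate F n y) (tv_iterate G n x) \<le> \<eta>"
        by (simp add: shadow_set_def)
      with \<eta>(2) show "tv_iterate F n y \<in> cball (tv_iterate G n x) \<epsilon>"
        by (simp add: dist_commute)
    qed
    from usc cv dom full null ball image
    show "\<exists>H :: 'a \<Rightarrow> 'a set.
        upper_semicontinuous H \<and> compact_valued H \<and> Dom H \<in> sets \<mu> \<and>
        emeasure \<mu> (UNIV - Dom H) = 0 \<and>
        (\<forall>x. H x \<in> null_sets \<mu>) \<and>
        (\<forall>x. H x \<subseteq> ball x \<epsilon>) \<and>
        (\<forall>x n. tv_iterate F n ` H x \<subseteq> cball (tv_iterate G n x) \<epsilon>)"
      by blast
  qed
qed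

end
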